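(* For all odd primes $p$, $$ A\left(\frac{p-1}{2}\right)\equiv C_6\left(\frac{p-1}{2}\right)\pmod{p^2}. $$
   Context: For integers $n\ge0$, the Apéry numbers are $$ A(n)=\sum_{k=0}^n\binom{n}{k}^2\binom{n+k}{k}^2, $$ and $$ C_6(n)=\sum_{k=0}^n\binom{n}{k}^6\bigl(1-6k(H_k-H_{n-k})\bigr), $$ where $H_n=\sum_{j=1}^n\frac1j$ denotes the $n$th harmonic number, with $H_0=0$. (The numbers $C_6(n)$ are integers; alternatively, the congruence may be read in the ring of rationals with denominator prime to $p$.) *)

theory Defs
  imports Complex_Main "HOL-Computational_Algebra.Primes"
begin

definition apery :: "nat \<Rightarrow> nat" where
  "apery n = (\<Sum>k=0..n. (n choose k)^2 * ((n + k) choose k)^2)"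

(* The harm of HOL-Analysis needs a real_normed_field, so it is not available on rat. *)
definition harmonic :: "nat \<Rightarrow> rat" where
  "harmonic n = (\<Sum>j=1..n. 1 / of_nat j)"

definition C6 :: "nat \<Rightarrow> rat" where
  "C6 n = (\<Sum>k=0..n. of_nat (n choose k)^6 *
            (1 - 6 * of_nat k * (harmonic k - harmonic (n - k))))"

(* quotient_of returns the fraction in lowest terms with positive denominator, so for
   prime p this is the localization of the integers at p. *)
definition p_integral :: "nat \<Rightarrow> rat set" where
  "p_integral p = {x. coprime (snd (quotient_of x)) (int p)}"

(* Congruence modulo m in the ring of rationals with denominator prime to p. If x and y are
   integers, p is prime and m is a power of p, it is the ordinary congruence of integers. *)
definition rat_cong :: "nat \<Rightarrow> nat \<Rightarrow> rat \<Rightarrow> rat \<Rightarrow> bool" where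
  "rat_cong p m x y \<longleftrightarrow>
     x \<in> p_integral p \<and> y \<in> p_integral p \<and> (\<exists>z\<in>p_integral p. x - y = of_nat m * z)"

end

theory Submission
  imports Defs
begin

text \<open>
Put $n = (p-1)/2$. The harmonic numbers in $C_6(n)$ disappear once $C_6(n)$ is rewritten as
  $$C_6(n) = (-1)^n \sum_k \binom{n}{k}^2 \binom{n+k}{n} \binom{2n-k}{n},$$
which holds for every $n$ (\<open>C6_eq_binomial_sum\<close>). After that the congruence comes from
completing a square. Write $B_k = \binom{n+k}{n}$, so that $\binom{2n-k}{n} = B_{n-k}$. Since
$\binom{n}{k} = \binom{n}{n-k}$, the sum $\sum_k \binom{n}{k}^2 B_k^2$ equals
$\sum_k \binom{n}{k}^2 B_{n-k}^2$; both are $A(n)$, whence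
  $$2 A(n) - 2 C_6(n) = \sum_k \binom{n}{k}^2 \bigl(B_k - (-1)^n B_{n-k}\bigr)^2.$$
Modulo $p = 2n+1$ the factors $k+1, \dots, k+n$ of $n!\,B_k$ are the negatives of the factors
$2n-k, \dots, n-k+1$ of $n!\,B_{n-k}$, so each bracket is divisible by $p$ and its square by $p^2$.

The formula for $C_6(n)$ is a degenerate case of Whipple's transformation of a terminating very
well-poised ${}_7F_6$ series into a balanced ${}_4F_3$. Take the base parameter $a = x - n$
and all five other parameters equal to $-n$. At $x = 0$ the left side is
$\sum_k (2k-n) \binom{n}{k}^6$, which vanishes because $k \mapsto n-k$ changes its sign; its
derivative at $0$ is $C_6(n)$, the harmonic numbers being logarithmic derivatives of rising
factorials. The right side has an explicit factor $x$, from $(x-n)_{n+1} = x\,(x-n)_n$, so its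
derivative at $0$ is the value of the cofactor, which is the binomial sum.

Whipple's transformation is proved as in Bailey's work: a case of the Pfaff-Saalschuetz summation
expands one pair of numerator parameters, and after the two sums are exchanged the inner one is a
very well-poised ${}_5F_4$ that has a closed form. Both summations are proved by
creative telescoping.
\<close>

section \<open>Rising factorials and well-poised ratios\<close>

lemma pochhammer_neg_of_nat:
  assumes "j \<le> k"
  shows "pochhammer (- of_nat k :: 'a::field_char_0) j = (-1) ^ j * fact k / fact (k - j)"
  using assms
proof (induction j)
  case (Suc j)
  have "k - j = Suc (k - Suc j)" using Suc.prems by simp
  then have f: "fact (k - j) = (of_nat (k - j) :: 'a) * fact (k - Suc j)"
    by (metis fact_Suc)
  have "pochhammer (- of_nat k :: 'a) (Suc j) =
      (- 1) ^ j * fact k / fact (k - j) * - of_nat (k - j)"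
    using Suc by (simp add: pochhammer_Suc of_nat_diff)
  also have "of_nat (k - j) \<noteq> (0::'a)" using Suc.prems by simp
  then have "(- 1) ^ j * fact k / fact (k - j) * - of_nat (k - j) =
      (- 1) ^ Suc j * fact k / (fact (k - Suc j) :: 'a)"
    unfolding f by (simp add: divide_simps del: of_nat_diff)
  finally show ?case .
qed simp

text \<open>
The contribution of one numerator parameter $b$, with its partner $1 + a - b$ in the
denominator, to the $k$-th term of a well-poised series with base $a$.
\<close>
definition wp_ratio :: "'a::field_char_0 \<Rightarrow> 'a \<Rightarrow> nat \<Rightarrow> 'a" where
  "wp_ratio a b k = pochhammer b k / pochhammer (1 + a - b) k"

text \<open>
Starting a well-poised series at index $j$ gives a well-poised series again, with base
$a + 2j$ in place of $a$ and $b + j$ in place of $b$.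
\<close>
lemma wp_ratio_add:
  "wp_ratio a b (j + l) = wp_ratio a b j * wp_ratio (a + 2 * of_nat j) (b + of_nat j) l"
proof -
  have "1 + (a + 2 * of_nat j) - (b + of_nat j) = 1 + a - b + of_nat j"
    by (simp add: algebra_simps)
  then show ?thesis
    unfolding wp_ratio_def by (simp only: pochhammer_product' times_divide_times_eq)
qed

lemma pochhammer_nonzeroI:
  fixes z :: "'a::field_char_0"
  assumes "\<And>i. z + of_nat i \<noteq> 0"
  shows "pochhammer z k \<noteq> 0"
  using assms by (auto simp: pochhammer_prod)

section \<open>Two terminating summations\<close>

text \<open>
The Pfaff-Saalschuetz sum, specialised so that it expands a product of two well-poised ratios.
Read in $j$, the factors depending on $k$ are $(-k)_j (a+k)_j$, and they are of the kind that
\<open>wp_ratio_add\<close> absorbs when such a product is inserted in another well-poised series.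

The proof is an induction on $k$. With $s(k,j)$ the summand, $B = 1+a-b$ and $C = 1+a-c$, the two
sides satisfy the same first-order recurrence because
$(B+k)(C+k)\,s(k+1,j) - (b+k)(c+k)\,s(k,j)$ is a difference in $j$ of the function $G$ below.
\<close>
theorem saalschutz_well_poised:
  fixes a b c :: "'a::field_char_0"
  assumes b: "\<And>i. 1 + a - b + of_nat i \<noteq> 0" and c: "\<And>i. 1 + a - c + of_nat i \<noteq> 0"
  shows "(\<Sum>j\<le>k. pochhammer (- of_nat k) j * pochhammer (a + of_nat k) j *
           (pochhammer (1 + a - b - c) j /
             (fact j * pochhammer (1 + a - b) j * pochhammer (1 + a - c) j))) =
         wp_ratio a b k * wp_ratio a c k"
proof (induction k)
  case 0
  show ?case by (simp add: wp_ratio_def)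
next
  case (Suc k)
  define B C D where "B = 1 + a - b" and "C = 1 + a - c" and "D = 1 + a - b - c"
  define w where "w = (\<lambda>j. pochhammer D j / (fact j * pochhammer B j * pochhammer C j))"
  define s where "s = (\<lambda>k j. pochhammer (- of_nat k) j * pochhammer (a + of_nat k) j * w j)"
  define G where "G = (\<lambda>j. (2 * of_nat k + 1 + a) * pochhammer (- of_nat k) j *
      pochhammer (a + of_nat k + 1) j * ((D + of_nat j) * w j))"
  have Bne: "B + of_nat i \<noteq> 0" and Cne: "C + of_nat i \<noteq> 0" for i
    using b c by (auto simp: B_def C_def)
  have w_Suc: "(D + of_nat j) * w j = w (Suc j) * (1 + of_nat j) * (B + of_nat j) * (C + of_nat j)"
    for j
  proof -
    have "pochhammer B j \<noteq> 0" "pochhammer C j \<noteq> 0" "(1 + of_nat j :: 'a) \<noteq> 0"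
      using Bne Cne pochhammer_nonzeroI of_nat_neq_0[of j, where ?'a = 'a] by auto
    then show ?thesis
      using Bne[of j] Cne[of j] unfolding w_def pochhammer_Suc fact_Suc
      by (simp add: divide_simps)
  qed
  \<comment> \<open>G is the partial sum up to J, so the sum over the full range vanishes with G (Suc k).\<close>
  have telescope: "(\<Sum>j\<le>J. (B + of_nat k) * (C + of_nat k) * s (Suc k) j -
      (b + of_nat k) * (c + of_nat k) * s k j) = G J" for J
  proof (induction J)
    case 0
    show ?case
      by (simp add: s_def G_def w_def B_def C_def D_def) (simp add: algebra_simps)
  next
    case (Suc j)
    \<comment> \<open>Every term of the identity is a polynomial times q * w (Suc j); w (Suc j) rather than w j
      avoids division.\<close>
    define q where "q = pochhammer (- of_nat k :: 'a) j * pochhammer (a + of_nat k + 1) j"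
    have s1: "s (Suc k) (Suc j) = - (1 + of_nat k) * (a + of_nat k + 1 + of_nat j) * q * w (Suc j)"
      unfolding s_def q_def pochhammer_rec[of "- of_nat (Suc k)"] pochhammer_Suc[of "a + _"]
      by (simp add: algebra_simps)
    have s2: "s k (Suc j) = (of_nat j - of_nat k) * (a + of_nat k) * q * w (Suc j)"
      unfolding s_def q_def pochhammer_rec[of "a + of_nat k"] pochhammer_Suc[of "- of_nat k"]
      by (simp add: algebra_simps)
    have G1: "G j = (2 * of_nat k + 1 + a) * q *
        (w (Suc j) * (1 + of_nat j) * (B + of_nat j) * (C + of_nat j))"
      unfolding G_def w_Suc q_def by simp
    have G2: "G (Suc j) = (2 * of_nat k + 1 + a) * q * (of_nat j - of_nat k) *
        (a + of_nat k + 1 + of_nat j) * (D + 1 + of_nat j) * w (Suc j)"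
      unfolding G_def q_def pochhammer_Suc by (simp add: algebra_simps)
    have "(B + of_nat k) * (C + of_nat k) * s (Suc k) (Suc j) -
      (b + of_nat k) * (c + of_nat k) * s k (Suc j) = G (Suc j) - G j"
      unfolding s1 s2 G1 G2 B_def C_def D_def by algebra
    then show ?case using Suc by simp
  qed
  have "s k (Suc k) = 0" "G (Suc k) = 0"
    by (simp_all add: s_def G_def pochhammer_of_nat_eq_0_lemma)
  then have "(B + of_nat k) * (C + of_nat k) * (\<Sum>j\<le>Suc k. s (Suc k) j) =
      (b + of_nat k) * (c + of_nat k) * (\<Sum>j\<le>k. s k j)"
    using telescope[of "Suc k"]
    by (simp add: sum_subtractf sum_distrib_left distrib_left del: of_nat_Suc)
  also have "(\<Sum>j\<le>k. s k j) = wp_ratio a b k * wp_ratio a c k"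
    using Suc unfolding s_def w_def B_def C_def D_def .
  finally have "(\<Sum>j\<le>Suc k. s (Suc k) j) = (b + of_nat k) * (c + of_nat k) *
      (wp_ratio a b k * wp_ratio a c k) / ((B + of_nat k) * (C + of_nat k))"
    using Bne[of k] Cne[of k]
    by (subst nonzero_eq_divide_eq) (simp_all add: mult_ac del: sum.atMost_Suc of_nat_Suc)
  also have "\<dots> = wp_ratio a b (Suc k) * wp_ratio a c (Suc k)"
    unfolding wp_ratio_def pochhammer_Suc B_def[symmetric] C_def[symmetric] by (simp add: mult_ac)
  finally have "(\<Sum>j\<le>Suc k. s (Suc k) j) = wp_ratio a b (Suc k) * wp_ratio a c (Suc k)" .
  then show ?case unfolding s_def w_def B_def C_def D_def .
qed

text \<open>
Induction on $m$ by creative telescoping again: with $t(m,l)$ the summand, $B = 1+a-b$,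
$C = 1+a-c$ and $D = 1+a-b-c$, the combination
$(B+m)(C+m)\,t(m+1,l) - (1+a+m)(D+m)\,t(m,l)$, whose coefficients are dictated by the
recurrence of the closed form in $m$, is a difference in $l$.

For $a \neq 0$, division by $a$ gives the usual normalisation of the series; the form used here has
the factor $(a)_{m+1}$ on the right, the source of the factor $x$ in the proof of
\<open>C6_eq_binomial_sum\<close>.
\<close>
theorem very_well_poised_5F4:
  fixes a b c :: "'a::field_char_0"
  assumes a: "\<And>i. 1 + a + of_nat i \<noteq> 0"
    and b: "\<And>i. 1 + a - b + of_nat i \<noteq> 0" and c: "\<And>i. 1 + a - c + of_nat i \<noteq> 0"
  shows "(\<Sum>l\<le>m. (a + 2 * of_nat l) * pochhammer a l / fact l *
           wp_ratio a b l * wp_ratio a c l * wp_ratio a (- of_nat m) l) =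
         pochhammer a (Suc m) * pochhammer (1 + a - b - c) m /
           (pochhammer (1 + a - b) m * pochhammer (1 + a - c) m)"
proof (induction m)
  case 0
  show ?case by (simp add: wp_ratio_def)
next
  case (Suc m)
  define B C D where "B = 1 + a - b" and "C = 1 + a - c" and "D = 1 + a - b - c"
  define v where "v = (\<lambda>l. pochhammer a l / fact l * wp_ratio a b l * wp_ratio a c l)"
  define t where "t = (\<lambda>m l. (a + 2 * of_nat l) * v l * wp_ratio a (- of_nat m) l)"
  define G where "G = (\<lambda>l. pochhammer (- of_nat m) l / pochhammer (a + of_nat m + 2) l *
      (v l * (a + of_nat l) * (b + of_nat l) * (c + of_nat l)))"
  have Bne: "B + of_nat i \<noteq> 0" and Cne: "C + of_nat i \<noteq> 0" for i
    using b c by (auto simp: B_def C_def)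
  have v_Suc: "v l * (a + of_nat l) * (b + of_nat l) * (c + of_nat l) =
      v (Suc l) * (1 + of_nat l) * (B + of_nat l) * (C + of_nat l)" for l
  proof -
    have "pochhammer B l \<noteq> 0" "pochhammer C l \<noteq> 0" "(1 + of_nat l :: 'a) \<noteq> 0"
      using Bne Cne pochhammer_nonzeroI of_nat_neq_0[of l, where ?'a = 'a] by auto
    then show ?thesis
      using Bne[of l] Cne[of l]
      unfolding v_def wp_ratio_def pochhammer_Suc fact_Suc B_def[symmetric] C_def[symmetric]
      by (simp add: divide_simps)
  qed
  have telescope: "(\<Sum>l\<le>L. (B + of_nat m) * (C + of_nat m) * t (Suc m) l -
      (1 + a + of_nat m) * (D + of_nat m) * t m l) = G L" for L
  proof (induction L)
    case 0
    show ?case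
      by (simp add: t_def G_def v_def wp_ratio_def B_def C_def D_def) (simp add: algebra_simps)
  next
    case (Suc l)
    define h where "h = a + of_nat m + 2 + of_nat l"
    \<comment> \<open>The common factor of the terms; dividing by h accounts for the longest denominator, that of
      t (Suc m) (Suc l).\<close>
    define Q where "Q = pochhammer (- of_nat m) l / pochhammer (a + of_nat m + 2) l / h"
    have h: "h \<noteq> 0" using a[of "m + l + 1"] by (simp add: h_def algebra_simps)
    have hQ: "h * Q = pochhammer (- of_nat m) l / pochhammer (a + of_nat m + 2) l"
      using h by (simp add: Q_def)
    have a1: "a + of_nat m + 1 \<noteq> 0" using a[of m] by (simp add: algebra_simps)
    have t1: "t (Suc m) (Suc l) = - (a + 2 * of_nat l + 2) * (1 + of_nat m) * Q * v (Suc l)"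
    proof -
      have "wp_ratio a (- of_nat (Suc m)) (Suc l) = - (1 + of_nat m) * Q"
        unfolding wp_ratio_def Q_def pochhammer_rec[of "- of_nat (Suc m)"]
          pochhammer_Suc[of "1 + a - _"]
        by (simp add: algebra_simps h_def)
      then show ?thesis
        unfolding t_def by (simp only:) (simp add: algebra_simps)
    qed
    have t2: "(1 + a + of_nat m) * t m (Suc l) =
        (a + 2 * of_nat l + 2) * (of_nat l - of_nat m) * h * Q * v (Suc l)"
    proof -
      have "wp_ratio a (- of_nat m) (Suc l) =
          (of_nat l - of_nat m) * (h * Q) / (a + of_nat m + 1)"
        unfolding wp_ratio_def hQ pochhammer_rec[of "1 + a - _"] pochhammer_Suc[of "- of_nat m"]
        by (simp add: add_ac mult_ac)
      then have eq: "(1 + a + of_nat m) * wp_ratio a (- of_nat m) (Suc l) =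
          (of_nat l - of_nat m) * (h * Q)"
        using a1 by (simp add: add_ac)
      have "(1 + a + of_nat m) * t m (Suc l) = (a + 2 * of_nat l + 2) *
          ((1 + a + of_nat m) * wp_ratio a (- of_nat m) (Suc l)) * v (Suc l)"
        by (simp add: t_def algebra_simps)
      then show ?thesis
        unfolding eq by (simp only: mult.assoc)
    qed
    have G1: "G l = h * Q * (v (Suc l) * (1 + of_nat l) * (B + of_nat l) * (C + of_nat l))"
      unfolding G_def v_Suc Q_def using h by simp
    have G2: "G (Suc l) = (of_nat l - of_nat m) * Q *
        (v (Suc l) * (a + of_nat l + 1) * (b + of_nat l + 1) * (c + of_nat l + 1))"
      unfolding G_def Q_def pochhammer_Suc by (simp add: algebra_simps h_def)
    have "(B + of_nat m) * (C + of_nat m) * t (Suc m) (Suc l) -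
      (1 + a + of_nat m) * (D + of_nat m) * t m (Suc l) =
      (B + of_nat m) * (C + of_nat m) * t (Suc m) (Suc l) -
      (D + of_nat m) * ((1 + a + of_nat m) * t m (Suc l))" by simp
    also have "\<dots> = G (Suc l) - G l"
      unfolding t1 t2 G1 G2 B_def C_def D_def h_def by algebra
    finally show ?case using Suc by simp
  qed
  have "t m (Suc m) = 0" "G (Suc m) = 0"
    by (simp_all add: t_def G_def wp_ratio_def pochhammer_of_nat_eq_0_lemma)
  then have "(B + of_nat m) * (C + of_nat m) * (\<Sum>l\<le>Suc m. t (Suc m) l) =
      (1 + a + of_nat m) * (D + of_nat m) * (\<Sum>l\<le>m. t m l)"
    using telescope[of "Suc m"]
    by (simp add: sum_subtractf sum_distrib_left distrib_left del: of_nat_Suc)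
  also have "(\<Sum>l\<le>m. t m l) =
      pochhammer a (Suc m) * pochhammer D m / (pochhammer B m * pochhammer C m)"
    using Suc unfolding t_def v_def B_def C_def D_def by (simp add: mult.assoc)
  finally have "(\<Sum>l\<le>Suc m. t (Suc m) l) = (1 + a + of_nat m) * (D + of_nat m) *
      (pochhammer a (Suc m) * pochhammer D m / (pochhammer B m * pochhammer C m)) /
      ((B + of_nat m) * (C + of_nat m))"
    using Bne[of m] Cne[of m]
    by (subst nonzero_eq_divide_eq) (simp_all add: mult_ac del: sum.atMost_Suc of_nat_Suc)
  also have "\<dots> = pochhammer a (Suc (Suc m)) * pochhammer D (Suc m) /
      (pochhammer B (Suc m) * pochhammer C (Suc m))"
    unfolding pochhammer_Suc[of a "Suc m"] pochhammer_Suc[of B] pochhammer_Suc[of C]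
      pochhammer_Suc[of D]
    by (simp add: mult_ac add_ac)
  finally have "(\<Sum>l\<le>Suc m. t (Suc m) l) = pochhammer a (Suc (Suc m)) * pochhammer D (Suc m) /
      (pochhammer B (Suc m) * pochhammer C (Suc m))" .
  then show ?case unfolding t_def v_def B_def C_def D_def by (simp add: mult.assoc)
qed

section \<open>Whipple's transformation\<close>

text \<open>
The parameters $b$ and $c$ are expanded by \<open>saalschutz_well_poised\<close>. Because of
$(-k)_j / k! = (-1)^j / (k-j)!$, the inner sum over $k$ starts at $j$; shifted by $j$
it is a \<open>very_well_poised_5F4\<close> with base $a + 2j$.

In the textbook form the right side has the ratio $(1+a-d-e)_n / (d+e-a-n)_j$. Writing it as
$(-1)^j (1+a-d-e)_{n-j}$ keeps the statement free of conditions on $d + e$.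
\<close>
theorem whipple_transformation:
  fixes a b c d e :: "'a::field_char_0"
  assumes a: "\<And>i. 1 + a + of_nat i \<noteq> 0"
    and b: "\<And>i. 1 + a - b + of_nat i \<noteq> 0" and c: "\<And>i. 1 + a - c + of_nat i \<noteq> 0"
    and d: "\<And>i. 1 + a - d + of_nat i \<noteq> 0" and e: "\<And>i. 1 + a - e + of_nat i \<noteq> 0"
  shows "(\<Sum>k\<le>n. (a + 2 * of_nat k) * pochhammer a k / fact k * wp_ratio a b k *
            wp_ratio a c k * wp_ratio a d k * wp_ratio a e k * wp_ratio a (- of_nat n) k) =
         pochhammer a (Suc n) / (pochhammer (1 + a - d) n * pochhammer (1 + a - e) n) *
         (\<Sum>j\<le>n. (- 1) ^ j * pochhammer (1 + a - b - c) j * pochhammer d j * pochhammer e j *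
            pochhammer (- of_nat n) j * pochhammer (1 + a - d - e) (n - j) /
            (fact j * pochhammer (1 + a - b) j * pochhammer (1 + a - c) j))"
proof -
  define w where "w = (\<lambda>j. pochhammer (1 + a - b - c) j /
      (fact j * pochhammer (1 + a - b) j * pochhammer (1 + a - c) j))"
  define r where "r = (\<lambda>k. wp_ratio a d k * wp_ratio a e k * wp_ratio a (- of_nat n) k)"
  define f where "f = (\<lambda>k j. (a + 2 * of_nat k) * (pochhammer a k * pochhammer (a + of_nat k) j) /
      fact (k - j) * r k * ((- 1) ^ j * w j))"
  have expand: "(a + 2 * of_nat k) * pochhammer a k / fact k * wp_ratio a b k *
            wp_ratio a c k * wp_ratio a d k * wp_ratio a e k * wp_ratio a (- of_nat n) k =
        (\<Sum>j\<le>k. f k j)" for k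
  proof -
    have "(a + 2 * of_nat k) * pochhammer a k / fact k * wp_ratio a b k *
            wp_ratio a c k * wp_ratio a d k * wp_ratio a e k * wp_ratio a (- of_nat n) k =
      (a + 2 * of_nat k) * pochhammer a k / fact k * r k * (wp_ratio a b k * wp_ratio a c k)"
      by (simp add: r_def mult_ac)
    also have "\<dots> = (\<Sum>j\<le>k. (a + 2 * of_nat k) * pochhammer a k / fact k * r k *
        (pochhammer (- of_nat k) j * pochhammer (a + of_nat k) j * w j))"
      unfolding saalschutz_well_poised[OF b c, of k, symmetric] w_def sum_distrib_left ..
    also have "\<dots> = (\<Sum>j\<le>k. f k j)"
      by (intro sum.cong) (simp_all add: f_def pochhammer_neg_of_nat)
    finally show ?thesis .
  qed
  have inner: "(\<Sum>k=j..n. f k j) =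
      pochhammer a (Suc n) / (pochhammer (1 + a - d) n * pochhammer (1 + a - e) n) *
      ((- 1) ^ j * w j * pochhammer d j * pochhammer e j * pochhammer (- of_nat n) j *
       pochhammer (1 + a - d - e) (n - j))" if j: "j \<le> n" for j
  proof -
    define m where "m = n - j"
    define a' d' e' where "a' = a + 2 * of_nat j" and "d' = d + of_nat j" and "e' = e + of_nat j"
    have n: "n = j + m" using j by (simp add: m_def)
    have neg_n: "- of_nat n + of_nat j = (- of_nat m :: 'a)" by (simp add: n)
    have shift: "1 + a' - d' = 1 + a - d + of_nat j" "1 + a' - e' = 1 + a - e + of_nat j"
      "1 + a' - d' - e' = 1 + a - d - e"
      by (simp_all add: a'_def d'_def e'_def algebra_simps)
    have poch: "pochhammer a (j + l) * pochhammer (a + of_nat (j + l)) j =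
        pochhammer a (2 * j) * pochhammer a' l" for l
    proof -
      have "pochhammer a (j + l) * pochhammer (a + of_nat (j + l)) j = pochhammer a (j + l + j)"
        by (simp only: pochhammer_product')
      also have "j + l + j = 2 * j + l" by simp
      also have "pochhammer a (2 * j + l) = pochhammer a (2 * j) * pochhammer a' l"
        by (simp add: pochhammer_product' a'_def)
      finally show ?thesis .
    qed
    have "(\<Sum>k=j..n. f k j) = (\<Sum>l\<le>m. f (j + l) j)"
      using sum.shift_bounds_cl_nat_ivl[of "\<lambda>k. f k j" 0 j m]
      by (simp add: n atLeast0AtMost add_ac)
    also have "\<dots> = (\<Sum>l\<le>m. (- 1) ^ j * w j * pochhammer a (2 * j) * r j *
       ((a' + 2 * of_nat l) * pochhammer a' l / fact l *
           wp_ratio a' d' l * wp_ratio a' e' l * wp_ratio a' (- of_nat m) l))"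
    proof (rule sum.cong, rule refl)
      fix l
      have "r (j + l) = r j * (wp_ratio a' d' l * wp_ratio a' e' l * wp_ratio a' (- of_nat m) l)"
        unfolding r_def wp_ratio_add a'_def[symmetric] d'_def[symmetric] e'_def[symmetric] neg_n
        by (simp add: mult_ac)
      moreover have "a + 2 * of_nat (j + l) = a' + 2 * of_nat l"
        by (simp add: a'_def algebra_simps)
      ultimately show "f (j + l) j = (- 1) ^ j * w j * pochhammer a (2 * j) * r j *
       ((a' + 2 * of_nat l) * pochhammer a' l / fact l *
           wp_ratio a' d' l * wp_ratio a' e' l * wp_ratio a' (- of_nat m) l)"
        unfolding f_def poch by (simp add: mult_ac)
    qed
    also have "\<dots> = (- 1) ^ j * w j * pochhammer a (2 * j) * r j *
        (pochhammer a' (Suc m) * pochhammer (1 + a' - d' - e') m /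
          (pochhammer (1 + a' - d') m * pochhammer (1 + a' - e') m))"
    proof -
      have ne: "1 + a' + of_nat i \<noteq> 0" "1 + a' - d' + of_nat i \<noteq> 0" "1 + a' - e' + of_nat i \<noteq> 0" for i
        using a[of "2 * j + i"] d[of "j + i"] e[of "j + i"] unfolding shift
        by (simp_all add: a'_def algebra_simps)
      show ?thesis
        unfolding sum_distrib_left[symmetric] very_well_poised_5F4[OF ne] ..
    qed
    also have "\<dots> = (- 1) ^ j * w j * pochhammer d j * pochhammer e j * pochhammer (- of_nat n) j *
        pochhammer (1 + a - d - e) m *
        (pochhammer a (2 * j) * pochhammer a' (Suc m) / pochhammer (1 + a + of_nat n) j) /
        ((pochhammer (1 + a - d) j * pochhammer (1 + a - d + of_nat j) m) *
         (pochhammer (1 + a - e) j * pochhammer (1 + a - e + of_nat j) m))"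
      unfolding shift(3) unfolding shift(1,2) r_def wp_ratio_def by (simp add: mult_ac)
    also have "pochhammer a (2 * j) * pochhammer a' (Suc m) / pochhammer (1 + a + of_nat n) j =
        pochhammer a (Suc n)"
    proof -
      have "pochhammer a (2 * j) * pochhammer a' (Suc m) = pochhammer a (2 * j + Suc m)"
        unfolding a'_def pochhammer_product' by simp
      also have "2 * j + Suc m = Suc n + j" by (simp add: n)
      also have "pochhammer a (Suc n + j) = pochhammer a (Suc n) * pochhammer (1 + a + of_nat n) j"
        unfolding pochhammer_product' by (simp add: add_ac)
      finally have "pochhammer a (2 * j) * pochhammer a' (Suc m) =
          pochhammer a (Suc n) * pochhammer (1 + a + of_nat n) j" .
      moreover have "pochhammer (1 + a + of_nat n) j \<noteq> 0"
        by (rule pochhammer_nonzeroI) (use a[of "n + _"] in \<open>simp add: add_ac\<close>)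
      ultimately show ?thesis by simp
    qed
    finally show ?thesis
      unfolding n by (simp add: pochhammer_product' mult_ac)
  qed
  have "(\<Sum>k\<le>n. \<Sum>j\<le>k. f k j) = (\<Sum>j\<le>n. \<Sum>k=j..n. f k j)"
    by (subst sum.Sigma, simp, simp, subst sum.Sigma, simp, simp)
      (rule sum.reindex_bij_witness[of _ prod.swap prod.swap]; auto)
  then show ?thesis
    unfolding expand by (simp add: inner w_def sum_distrib_left mult_ac)
qed

section \<open>$C_6$ as a sum of binomial products\<close>

definition C6_binomial_sum :: "nat \<Rightarrow> nat" where
  "C6_binomial_sum n = (\<Sum>k\<le>n. (n choose k)^2 * ((n + k) choose n) * ((2 * n - k) choose n))"

lemma sum_antisymmetric:
  fixes f :: "nat \<Rightarrow> real"
  assumes "\<And>k. k \<le> n \<Longrightarrow> f (n - k) = - f k"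
  shows "(\<Sum>k\<le>n. f k) = 0"
proof -
  have "(\<Sum>k\<le>n. f k) = (\<Sum>k\<le>n. f (n - k))"
    by (rule sum.reindex_bij_witness[of _ "\<lambda>k. n - k" "\<lambda>k. n - k"]) auto
  also have "\<dots> = - (\<Sum>k\<le>n. f k)"
    by (simp add: assms sum_negf[symmetric])
  finally show ?thesis by simp
qed

abbreviation H :: "nat \<Rightarrow> real" where
  "H n \<equiv> of_rat (harmonic n)"

lemma H_Suc: "H (Suc n) = H n + 1 / real (Suc n)"
  by (simp add: harmonic_def of_rat_add of_rat_divide)

lemma of_rat_C6:
  "of_rat (C6 n) = (\<Sum>k\<le>n. real (n choose k)^6 * (1 - 6 * real k * (H k - H (n - k))))"
  by (simp add: C6_def of_rat_sum of_rat_mult of_rat_power of_rat_diff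
      atLeast0AtMost)

text \<open>
The weight $\binom{n}{k}^6$ deformed by a parameter $x$: apart from its very well-poised
factor $x - n + 2k$, the $k$-th term of Whipple's series with base $x - n$ and the other five
parameters equal to $-n$.
\<close>
definition perturbed_weight :: "nat \<Rightarrow> nat \<Rightarrow> real \<Rightarrow> real" where
  "perturbed_weight n k x =
     pochhammer (x - real n) k / fact k * wp_ratio (x - real n) (- real n) k ^ 5"

lemma perturbed_weight_alt:
  "perturbed_weight n k x =
     pochhammer (x - real n) k / fact k * (pochhammer (- real n) k / pochhammer (1 + x) k) ^ 5"
  by (simp add: perturbed_weight_def wp_ratio_def)

lemma perturbed_weight_0:
  assumes "k \<le> n"
  shows "perturbed_weight n k 0 = real (n choose k) ^ 6"
proof -
  define s :: real where "s = (-1) ^ k"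
  have s: "s * s = 1" by (simp add: s_def flip: power_add)
  have q: "pochhammer (- real n) k / fact k = s * real (n choose k)"
    using assms by (simp add: pochhammer_neg_of_nat binomial_fact s_def mult_ac)
  have "perturbed_weight n k 0 = (pochhammer (- real n) k / fact k) ^ 6"
    by (simp add: perturbed_weight_alt pochhammer_fact[symmetric] numeral_eq_Suc)
  also have "\<dots> = (s * s) ^ 3 * real (n choose k) ^ 6"
    unfolding q by algebra
  finally show ?thesis by (simp add: s)
qed

text \<open>
Going from $k$ to $k+1$ multiplies the weight by a constant times $(x-(n-k))/(x+k+1)^5$, whose
logarithmic derivative at $0$ is $-1/(n-k) - 5/(k+1)$. These increments add up to
$H_{n-k} - H_n - 5 H_k$.
\<close>
lemma perturbed_weight_deriv:
  assumes "k \<le> n"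
  shows "(perturbed_weight n k has_field_derivative
      perturbed_weight n k 0 * (H (n - k) - H n - 5 * H k)) (at 0)"
  using assms
proof (induction k)
  case 0
  show ?case by (simp add: perturbed_weight_alt harmonic_def)
next
  case (Suc k)
  have weight_Suc: "perturbed_weight n (Suc k) = (\<lambda>x. perturbed_weight n k x *
      ((x - real n + real k) / (1 + real k) * ((real k - real n) / (1 + x + real k)) ^ 5))"
    by (rule ext) (simp add: perturbed_weight_alt pochhammer_Suc power_mult_distrib power_divide
        mult_ac add_ac)
  define r where "r = real n - real k"
  have r: "r \<noteq> 0" using Suc.prems by (simp add: r_def)
  define s where "s = 1 + real k"
  have s: "s \<noteq> 0" by (simp add: s_def)
  have "n - k = Suc (n - Suc k)" using Suc.prems by simp
  then have "H (n - k) = H (n - Suc k) + 1 / real (n - k)" by (simp add: H_Suc)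
  then have H1: "H (n - Suc k) = H (n - k) - 1 / r"
    using Suc.prems by (simp add: r_def of_nat_diff)
  have H2: "H (Suc k) = H k + 1 / s" by (simp add: H_Suc s_def)
  define g where "g = (\<lambda>x. (x - r) / s * (- r / (x + s)) ^ 5)"
  have g: "perturbed_weight n (Suc k) = (\<lambda>x. perturbed_weight n k x * g x)"
    unfolding weight_Suc g_def r_def s_def by (simp add: algebra_simps)
  have g': "(g has_field_derivative g 0 * (- 1 / r - 5 / s)) (at 0)"
    unfolding g_def using r s
    by (auto intro!: derivative_eq_intros simp: field_simps power_Suc numeral_eq_Suc)
  have "((\<lambda>x. perturbed_weight n k x * g x) has_field_derivative
      perturbed_weight n k 0 * (H (n - k) - H n - 5 * H k) * g 0 +
      g 0 * (- 1 / r - 5 / s) * perturbed_weight n k 0) (at 0)"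
    using Suc by (intro DERIV_mult g') simp
  also have "perturbed_weight n k 0 * (H (n - k) - H n - 5 * H k) * g 0 +
      g 0 * (- 1 / r - 5 / s) * perturbed_weight n k 0 =
      perturbed_weight n k 0 * g 0 * (H (n - Suc k) - H n - 5 * H (Suc k))"
    unfolding H1 H2 by (simp add: algebra_simps)
  finally show ?case unfolding g .
qed

text \<open>
The derivative at $0$ is $\sum_k \binom{n}{k}^6 \bigl(1 + (2k-n)(H_{n-k} - H_n - 5 H_k)\bigr)$. Its
difference from $C_6(n)$ is a sum whose terms change sign under $k \mapsto n-k$.
\<close>
lemma C6_as_derivative:
  "((\<lambda>x. \<Sum>k\<le>n. (x - real n + 2 * real k) * perturbed_weight n k x)
    has_field_derivative of_rat (C6 n)) (at 0)"
proof -
  define P where "P = (\<lambda>k. real (n choose k) ^ 6)"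
  have P_sym: "P (n - k) = P k" if "k \<le> n" for k
    using that by (simp add: P_def binomial_symmetric[of k n])
  define A where "A = (\<lambda>k. P k *
      ((2 * real k - real n) * (H (n - k) - H n - 5 * H k) + 6 * real k * (H k - H (n - k))))"
  have "((\<lambda>x. \<Sum>k\<le>n. (x - real n + 2 * real k) * perturbed_weight n k x) has_field_derivative
      (\<Sum>k\<le>n. P k + P k * ((2 * real k - real n) * (H (n - k) - H n - 5 * H k)))) (at 0)"
  proof (rule DERIV_sum)
    fix k assume "k \<in> {..n}"
    then have k: "k \<le> n" by simp
    show "((\<lambda>x. (x - real n + 2 * real k) * perturbed_weight n k x) has_field_derivative
      P k + P k * ((2 * real k - real n) * (H (n - k) - H n - 5 * H k))) (at 0)"
      by (rule derivative_eq_intros perturbed_weight_deriv[OF k] refl)+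
        (simp add: perturbed_weight_0[OF k] P_def algebra_simps)
  qed
  also have "(\<Sum>k\<le>n. P k + P k * ((2 * real k - real n) * (H (n - k) - H n - 5 * H k))) =
      of_rat (C6 n) + (\<Sum>k\<le>n. A k)"
    unfolding of_rat_C6 sum.distrib[symmetric] P_def A_def
    by (rule sum.cong) (simp_all add: algebra_simps)
  also have "(\<Sum>k\<le>n. A k) = 0"
  proof (rule sum_antisymmetric)
    fix k assume "k \<le> n"
    then show "A (n - k) = - A k"
      by (simp add: A_def P_sym of_nat_diff) (simp add: algebra_simps)
  qed
  finally show ?thesis by simp
qed

lemma isCont_pochhammer:
  fixes f :: "real \<Rightarrow> real"
  assumes "isCont f x"
  shows "isCont (\<lambda>x. pochhammer (f x) k) x"
  unfolding pochhammer_prod using assms by (intro continuous_intros)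

text \<open>
Whipple's transformation identifies the deformed sum with $x\,g(x)$ for $0 < |x| < 1$; the
exclusion of integers keeps $1 + a + i = x - n + 1 + i$ away from zero. Antisymmetry gives the
same equation at $x = 0$, so that the derivatives at $0$ agree. That of $x\,g(x)$ is $g(0)$
because $g$ is continuous there.
\<close>
theorem C6_eq_binomial_sum: "C6 n = (- 1) ^ n * of_nat (C6_binomial_sum n)"
proof -
  define g where "g = (\<lambda>x. pochhammer (x - real n) n / (pochhammer (1 + x) n * pochhammer (1 + x) n) *
         (\<Sum>j\<le>n. (- 1) ^ j * pochhammer (1 + x + real n) j * pochhammer (- real n) j ^ 3 *
            pochhammer (1 + x + real n) (n - j) /
            (fact j * pochhammer (1 + x) j * pochhammer (1 + x) j)))"
  have "pochhammer (1 + 0) k \<noteq> (0::real)" for k by (simp add: pochhammer_fact[symmetric])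
  then have "isCont g 0"
    unfolding g_def by (intro continuous_intros isCont_pochhammer) auto
  then have deriv_rhs: "((\<lambda>x. x * g x) has_field_derivative g 0) (at 0)"
    by (intro iffD2[OF CARAT_DERIV] exI[of _ g]) simp
  have "(\<Sum>k\<le>n. (x - real n + 2 * real k) * perturbed_weight n k x) = x * g x"
    if x: "x \<in> {-1<..<1}" for x
  proof (cases "x = 0")
    case True
    have "(\<Sum>k\<le>n. (2 * real k - real n) * real (n choose k) ^ 6) = 0"
      by (rule sum_antisymmetric)
        (simp add: of_nat_diff binomial_symmetric[symmetric] algebra_simps)
    then show ?thesis by (simp add: True perturbed_weight_0)
  next
    case False
    have nonint: "x + of_int z \<noteq> 0" for z
    proof
      assume "x + of_int z = 0"
      then have "x = of_int (- z)" by simp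
      with x False show False by auto
    qed
    have "1 + (x - real n) + real i \<noteq> 0" for i
      using nonint[of "1 - int n + int i"] by (simp add: algebra_simps)
    moreover have "1 + (x - real n) - (- real n) + real i \<noteq> 0" for i
      using nonint[of "1 + int i"] by (simp add: algebra_simps)
    ultimately have "(\<Sum>k\<le>n. (x - real n + 2 * real k) * perturbed_weight n k x) =
        pochhammer (x - real n) (Suc n) / (pochhammer (1 + x) n * pochhammer (1 + x) n) *
         (\<Sum>j\<le>n. (- 1) ^ j * pochhammer (1 + x + real n) j * pochhammer (- real n) j ^ 3 *
            pochhammer (1 + x + real n) (n - j) /
            (fact j * pochhammer (1 + x) j * pochhammer (1 + x) j))"
      using whipple_transformation[of "x - real n" "- real n" "- real n" "- real n" "- real n" n]
      by (simp add: perturbed_weight_def power3_eq_cube numeral_eq_Suc mult_ac)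
    then show ?thesis by (simp add: g_def pochhammer_Suc mult_ac)
  qed
  then have "((\<lambda>x. x * g x) has_field_derivative of_rat (C6 n)) (at 0)"
    by (intro has_field_derivative_transform_within_open[OF C6_as_derivative, of "{-1<..<1}"]) auto
  then have "of_rat (C6 n) = g 0"
    using deriv_rhs by (rule DERIV_unique)
  also have "g 0 = (- 1) ^ n *
      (\<Sum>j\<le>n. real ((n choose j)^2 * ((n + j) choose n) * ((2 * n - j) choose n)))"
  proof -
    have "pochhammer (0 - real n) n / (pochhammer (1 + 0) n * pochhammer (1 + 0) n) *
       ((- 1) ^ j * pochhammer (1 + 0 + real n) j * pochhammer (- real n) j ^ 3 *
            pochhammer (1 + 0 + real n) (n - j) /
            (fact j * pochhammer (1 + 0) j * pochhammer (1 + 0) j)) =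
       (- 1) ^ n * real ((n choose j)^2 * ((n + j) choose n) * ((2 * n - j) choose n))"
      if j: "j \<le> n" for j
    proof -
      have up: "pochhammer (1 + real n) i = fact (n + i) / fact n" for i
        using pochhammer_product'[of "1 :: real" n i] by (simp add: pochhammer_fact[symmetric])
      define s :: real where "s = (- 1) ^ j"
      have s: "s * s = 1" by (simp add: s_def flip: power_add)
      have "n + (n - j) = 2 * n - j" "2 * n - j - n = n - j" "n \<le> 2 * n - j" using j by auto
      then have choose: "real ((2 * n - j) choose n) = fact (2 * n - j) / (fact n * fact (n - j))"
          "real ((n + j) choose n) = fact (n + j) / (fact n * fact j)"
          "real (n choose j) = fact n / (fact j * fact (n - j))"
        and up': "pochhammer (1 + real n) (n - j) = fact (2 * n - j) / fact n"
        using j up[of "n - j"] by (simp_all add: binomial_fact)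
      have neg: "pochhammer (- real n) j = s * fact n / fact (n - j)"
        "pochhammer (- real n) n = (- 1) ^ n * fact n"
        using j by (simp_all add: pochhammer_neg_of_nat s_def)
      have "pochhammer (- real n) n / (fact n * fact n) *
         (s * pochhammer (1 + real n) j * pochhammer (- real n) j ^ 3 *
            pochhammer (1 + real n) (n - j) / (fact j * fact j * fact j)) =
         (s * s) ^ 2 * ((- 1) ^ n *
         real ((n choose j)^2 * ((n + j) choose n) * ((2 * n - j) choose n)))"
        unfolding of_nat_mult of_nat_power choose up' up[of j] neg
        by (simp add: divide_simps) (simp add: power2_eq_square power3_eq_cube numeral_eq_Suc)
      then show ?thesis
        by (simp add: s s_def[symmetric] pochhammer_fact[symmetric])
    qed
    then show ?thesis
      unfolding g_def sum_distrib_left by (intro sum.cong) simp_all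
  qed
  also have "\<dots> = of_rat ((- 1) ^ n * of_nat (C6_binomial_sum n))"
    by (simp add: C6_binomial_sum_def of_rat_mult of_rat_power of_rat_sum)
  finally show ?thesis by simp
qed

section \<open>The congruence\<close>

lemma dvd_pochhammer_diff:
  fixes a b m :: int
  assumes "m dvd a - b"
  shows "m dvd pochhammer a n - pochhammer b n"
proof (induction n)
  case (Suc n)
  have "pochhammer a (Suc n) - pochhammer b (Suc n) =
      (pochhammer a n - pochhammer b n) * (a + of_nat n) + pochhammer b n * (a - b)"
    by (simp add: pochhammer_Suc algebra_simps)
  with Suc assms show ?case by simp
qed simp

lemma fact_mult_choose: "fact n * int ((n + k) choose n) = pochhammer (1 + int k) n"
proof -
  have "fact k * (fact n * int ((n + k) choose n)) =
      int (fact n * fact (n + k - n) * ((n + k) choose n))"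
    by (simp add: mult_ac)
  also have "\<dots> = fact (k + n)"
    by (subst binomial_fact_lemma) (simp_all add: add.commute)
  also have "\<dots> = fact k * pochhammer (1 + int k) n"
    by (simp only: pochhammer_fact pochhammer_product')
  finally show ?thesis by simp
qed

text \<open>
After multiplication by $n!$, which is prime to $2n+1$, the two binomial coefficients become
rising factorials starting at $k + 1$ and, up to the sign $(-1)^n$, at $k - 2n$. These
starting points differ by $2n + 1$.
\<close>
lemma choose_reflect:
  assumes "prime (2 * n + 1)" and "k \<le> n"
  shows "int (2 * n + 1) dvd int ((n + k) choose n) - (- 1) ^ n * int ((2 * n - k) choose n)"
proof -
  have k: "n + (n - k) = 2 * n - k" using assms(2) by simp
  have "pochhammer (- (2 * int n - int k)) n =
      (- 1) ^ n * pochhammer (1 + int (n - k)) n"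
    using assms(2) pochhammer_minus[of "2 * int n - int k" n]
    by (simp add: of_nat_diff add.commute)
  then have "fact n * (int ((n + k) choose n) - (- 1) ^ n * int ((2 * n - k) choose n)) =
      pochhammer (1 + int k) n - pochhammer (- (2 * int n - int k)) n"
    using fact_mult_choose[of n k] fact_mult_choose[of n "n - k"] unfolding k
    by (simp add: algebra_simps)
  also have "int (2 * n + 1) dvd \<dots>"
    by (rule dvd_pochhammer_diff) simp
  finally have "int (2 * n + 1) dvd fact n \<or>
      int (2 * n + 1) dvd int ((n + k) choose n) - (- 1) ^ n * int ((2 * n - k) choose n)"
    using assms(1) by (simp add: prime_dvd_mult_iff del: of_nat_Suc of_nat_add of_nat_mult)
  moreover have "\<not> int (2 * n + 1) dvd fact n"
    using assms(1) prime_dvd_fact_iff[of "2 * n + 1" n]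
    by (subst of_nat_fact[symmetric], subst of_nat_dvd_iff) simp
  ultimately show ?thesis by blast
qed

text \<open>
Twice the difference is a sum of squares weighted by $\binom{n}{k}^2$, each square being that of
a number divisible by $2n+1$ according to \<open>choose_reflect\<close>.
\<close>
lemma apery_cong_binomial_sum:
  assumes "prime (2 * n + 1)"
  shows "(int (2 * n + 1))\<^sup>2 dvd int (apery n) - (- 1) ^ n * int (C6_binomial_sum n)"
proof -
  define s :: int where "s = (- 1) ^ n"
  define N B where "N = (\<lambda>k. (int (n choose k))\<^sup>2)" and "B = (\<lambda>k. int ((n + k) choose n))"
  have s: "s * s = 1" by (simp add: s_def flip: power_add)
  have N_sym: "N (n - k) = N k" if "k \<le> n" for k
    using that by (simp add: N_def binomial_symmetric[of k n])
  have apery: "int (apery n) = (\<Sum>k\<le>n. N k * (B k)\<^sup>2)"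
    using binomial_symmetric[of n "n + _"]
    by (simp add: apery_def N_def B_def atLeast0AtMost)
  also have "\<dots> = (\<Sum>k\<le>n. N k * (B (n - k))\<^sup>2)"
    by (rule sum.reindex_bij_witness[of _ "\<lambda>k. n - k" "\<lambda>k. n - k"]) (auto simp: N_sym)
  finally have apery': "int (apery n) = (\<Sum>k\<le>n. N k * (B (n - k))\<^sup>2)" .
  have C6: "int (C6_binomial_sum n) = (\<Sum>k\<le>n. N k * B k * B (n - k))"
    by (simp add: C6_binomial_sum_def N_def B_def mult_2)
  have "2 * (int (apery n) - s * int (C6_binomial_sum n)) =
      int (apery n) + s * s * int (apery n) - 2 * s * int (C6_binomial_sum n)"
    by (simp add: s)
  also have "\<dots> = (\<Sum>k\<le>n. N k * (B k)\<^sup>2) + s * s * (\<Sum>k\<le>n. N k * (B (n - k))\<^sup>2) -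
      2 * s * (\<Sum>k\<le>n. N k * B k * B (n - k))"
    unfolding apery[symmetric] apery'[symmetric] C6 ..
  also have "\<dots> = (\<Sum>k\<le>n. N k * (B k - s * B (n - k))\<^sup>2)"
    unfolding sum_distrib_left sum.distrib[symmetric] sum_subtractf[symmetric]
    by (rule sum.cong) (simp_all add: power2_eq_square algebra_simps)
  also have "(int (2 * n + 1))\<^sup>2 dvd \<dots>"
  proof (rule dvd_sum)
    fix k assume "k \<in> {..n}"
    then have k: "k \<le> n" and "n + (n - k) = 2 * n - k" by auto
    then have "int (2 * n + 1) dvd B k - s * B (n - k)"
      using choose_reflect[OF assms k] by (simp only: B_def s_def)
    then show "(int (2 * n + 1))\<^sup>2 dvd N k * (B k - s * B (n - k))\<^sup>2"
      by (intro dvd_mult dvd_power_same)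
  qed
  finally have "(int (2 * n + 1))\<^sup>2 dvd 2 * (int (apery n) - s * int (C6_binomial_sum n))" .
  moreover have "coprime ((int (2 * n + 1))\<^sup>2) 2"
    by simp
  ultimately show ?thesis
    unfolding s_def by (simp only: coprime_dvd_mult_right_iff)
qed

lemma rat_cong_of_int:
  assumes "int m dvd x - y"
  shows "rat_cong p m (of_int x) (of_int y)"
proof -
  have int: "of_int z \<in> p_integral p" for z
    by (simp add: p_integral_def quotient_of_int)
  from assms obtain z where "x - y = int m * z" by (elim dvdE)
  then have "of_int (x - y) = (of_int (int m * z) :: rat)" by (rule arg_cong)
  then have "of_int x - of_int y = of_nat m * (of_int z :: rat)" by simp
  then show ?thesis
    unfolding rat_cong_def using int by blast
qed

theorem lemma2p2:
  fixes p :: nat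
  assumes "prime p" and "odd p"
  shows "rat_cong p (p^2) (of_nat (apery ((p - 1) div 2))) (C6 ((p - 1) div 2))"
proof -
  define n where "n = (p - 1) div 2"
  have p: "p = 2 * n + 1" using assms(2) by (auto simp: n_def elim: oddE)
  have "int (p\<^sup>2) dvd int (apery n) - (- 1) ^ n * int (C6_binomial_sum n)"
    using apery_cong_binomial_sum[of n] assms(1) unfolding p of_nat_power .
  from rat_cong_of_int[OF this] show ?thesis
    unfolding n_def[symmetric] by (simp add: C6_eq_binomial_sum)
qed

end
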